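(* Let $d\ge1$, let $s=(s_0,\dots,s_d)$ be a sign sequence for $d$, let $z=z(s)$, and let $F\in S_d$ be a nonzero binary form of order $d$. (1) Assume $d$ is even. Then $\langle x_1x_2,F\rangle\in\widetilde{\mathcal Y}^\circ(z)$ if and only if $F$ is a linear combination of terms in the set $\{x_1^{d-i}x_2^i: s_i=1\}$. (2) Assume $d$ is odd. Then $\langle x_1x_2,F\rangle\in\widetilde{\mathcal Y}^\circ(z)$ if and only if $F$ is a linear combination of terms in either one of the sets $\{x_1^{d-i}x_2^i: s_i=1\}$ or $\{x_1^{d-i}x_2^i: s_i=-1\}$.
   Context: The base field is $\mathbb C$. $S_m$ denotes the space of binary forms of order (degree) $m$ in $x_1,x_2$. For $A\in S_m$, $B\in S_k$ and $0\le r\le\min(m,k)$ the $r$-th transvectant is $$(A,B)_r=\frac{(m-r)!\,(k-r)!}{m!\,k!}\sum_{i=0}^r(-1)^i\binom ri\frac{\partial^rA}{\partial x_1^{r-i}\partial x_2^i}\frac{\partial^rB}{\partial x_2^{r-i}\partial x_1^i}\in S_{m+k-2r}.$$ For $Q=q_0x_1^2+2q_1x_1x_2+q_2x_2^2\in S_2$ put $\Delta=\Delta_Q=-2(Q,Q)_2=4(q_1^2-q_0q_2)$. Let $n=\lfloor d/2\rfloor$. A sign sequence for $d$ is $s=(s_0,\dots,s_d)$ with $s_i\in\{\pm1\}$ and $s_{d-i}=(-1)^ds_i$ (for even $d$ the entry $s_{d/2}$ is arbitrary). For $0\le\ell\le n$ let $m_\ell=\frac12$ if $d=2\ell$ and $m_\ell=1$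 otherwise. Define $z(s)=(z_0(s),\dots,z_n(s))$ by $$z_i(s)=\frac{d!\,(2d-4i+1)!}{2^{2i-1}(d-2i)!^2}\ \sum s_\ell m_\ell(-1)^q\frac{(d-2e)!\,(d-i-e)!}{(2d-2i-2e+1)!\,(i-e)!\,p!\,q!\,(\ell-p)!\,(d-\ell-q)!},$$ the sum being over integer quadruples $(e,\ell,p,q)$ with $0\le e\le i$, $0\le\ell\le n$, $0\le p\le\ell$, $0\le q\le d-\ell$, $p+q=d-2e$. For $z=(z_0,\dots,z_n)\in\mathbb C^{n+1}$ and $Q\in S_2$, let $\sigma_{Q,z}:S_d\to S_d$ be $\sigma_{Q,z}(F)=\sum_{i=0}^n z_i\Delta^i(Q^{d-2i},F)_{d-2i}$. The locus $\widetilde{\mathcal Y}^\circ(z)\subseteq\mathbb P S_2\times\mathbb P S_d$ is the set of pairs $\langle Q,F\rangle$ with $\Delta_Q\ne0$ and $$\sigma_{Q,z}(F)=\Delta^{d/2}F\ \text{ if } d \text{ is even},\qquad [\sigma_{Q,z}(F)]^2=\Delta^dF^2\ \text{ if } d\text{ is odd}.$$ *)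

theory Defs
  imports Complex_Main "HOL-Computational_Algebra.Polynomial"
begin

text \<open>
  The ring \<open>\<complex>[x\<^sub>1, x\<^sub>2]\<close> is rendered as \<open>complex poly poly\<close>: the outer variable is \<open>x\<^sub>1\<close>, the inner one
  \<open>x\<^sub>2\<close>, so that \<open>coeff (coeff A i) j\<close> is the coefficient of \<open>x\<^sub>1\<^sup>i x\<^sub>2\<^sup>j\<close>.
\<close>

type_synonym bipoly = "complex poly poly"

definition X1 :: bipoly where "X1 = [:0, 1:]"
definition X2 :: bipoly where "X2 = [:[:0, 1:]:]"

definition cscale :: "complex \<Rightarrow> bipoly \<Rightarrow> bipoly" where
  "cscale c A = smult [:c:] A"

interpretation bipoly: vector_space cscale
  by unfold_locales
     (simp_all add: cscale_def smult_add_right mult.commute flip: smult_add_left one_pCons)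

definition forms :: "nat \<Rightarrow> bipoly set" where
  "forms m = {A. \<forall>i j. coeff (coeff A i) j \<noteq> 0 \<longrightarrow> i + j = m}"

definition D1 :: "bipoly \<Rightarrow> bipoly" where "D1 = pderiv"
definition D2 :: "bipoly \<Rightarrow> bipoly" where "D2 = map_poly pderiv"

text \<open>
  \<open>transvectant m k r A B\<close> is \<open>(A, B)\<^sub>r\<close> for \<open>A\<close> of order \<open>m\<close> and \<open>B\<close> of order \<open>k\<close>, \<open>r \<le> min m k\<close>. The orders
  are explicit parameters because the zero form has every order.
\<close>

definition transvectant :: "nat \<Rightarrow> nat \<Rightarrow> nat \<Rightarrow> bipoly \<Rightarrow> bipoly \<Rightarrow> bipoly" where
  "transvectant m k r A B =
     cscale (fact (m - r) * fact (k - r) / (fact m * fact k))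
       (\<Sum>i\<le>r. cscale ((-1) ^ i * of_nat (r choose i))
          ((D1 ^^ (r - i)) ((D2 ^^ i) A) * (D2 ^^ (r - i)) ((D1 ^^ i) B)))"

text \<open>For a quadratic form \<open>Q\<close> this has order 0, i.e. it is a constant of \<open>\<complex>[x\<^sub>1, x\<^sub>2]\<close>.\<close>

definition discr :: "bipoly \<Rightarrow> bipoly" where
  "discr Q = cscale (-2) (transvectant 2 2 2 Q Q)"

text \<open>
  The finite sequences \<open>s\<^sub>0, \<dots>, s\<^sub>d\<close> and \<open>z\<^sub>0, \<dots>, z\<^sub>n\<close>, \<open>n = d div 2\<close>, are functions on \<open>nat\<close> of which only
  the values in these index ranges matter.
\<close>

definition sign_sequence :: "nat \<Rightarrow> (nat \<Rightarrow> int) \<Rightarrow> bool" where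
  "sign_sequence d s \<longleftrightarrow> (\<forall>i\<le>d. s i \<in> {1, -1} \<and> s (d - i) = (-1) ^ d * s i)"

definition half_weight :: "nat \<Rightarrow> nat \<Rightarrow> complex" where
  "half_weight d l = (if d = 2 * l then 1 / 2 else 1)"

text \<open>
  For \<open>i \<le> d div 2\<close> none of the natural number subtractions below is truncated; only the exponent
  \<open>2i - 1\<close> of 2 can be negative.
\<close>

definition zseq :: "nat \<Rightarrow> (nat \<Rightarrow> int) \<Rightarrow> nat \<Rightarrow> complex" where
  "zseq d s i =
     fact d * fact (2 * d - 4 * i + 1) / (2 powi (2 * int i - 1) * (fact (d - 2 * i))\<^sup>2) *
     (\<Sum>(e, l, p, q) \<in> {(e, l, p, q). e \<le> i \<and> l \<le> d div 2 \<and> p \<le> l \<and> q \<le> d - l \<and> p + q = d - 2 * e}.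
        of_int (s l) * half_weight d l * (-1) ^ q *
        (fact (d - 2 * e) * fact (d - i - e) /
         (fact (2 * d - 2 * i - 2 * e + 1) * fact (i - e) * fact p * fact q *
          fact (l - p) * fact (d - l - q))))"

definition sigma :: "nat \<Rightarrow> bipoly \<Rightarrow> (nat \<Rightarrow> complex) \<Rightarrow> bipoly \<Rightarrow> bipoly" where
  "sigma d Q z F =
     (\<Sum>i\<le>d div 2. cscale (z i)
        (discr Q ^ i * transvectant (2 * (d - 2 * i)) d (d - 2 * i) (Q ^ (d - 2 * i)) F))"

text \<open>The point of projective space represented by a nonzero form, as its class up to nonzero scalars.\<close>

definition proj_pt :: "bipoly \<Rightarrow> bipoly set" where
  "proj_pt A = {cscale c A | c. c \<noteq> 0}"

text \<open>
  The locus in \<open>P(S\<^sub>2) \<times> P(S\<^sub>d)\<close>. Its equations are homogeneous of degree \<open>d\<close> (\<open>d\<close> even) or \<open>2d\<close> (\<open>d\<close> odd) in \<open>Q\<close>,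
  and of degree 1 or 2 in \<open>F\<close>, so they do not depend on the representatives.
\<close>

definition locus :: "nat \<Rightarrow> (nat \<Rightarrow> complex) \<Rightarrow> (bipoly set \<times> bipoly set) set" where
  "locus d z =
     {(proj_pt Q, proj_pt F) | Q F.
        Q \<in> forms 2 \<and> Q \<noteq> 0 \<and> F \<in> forms d \<and> F \<noteq> 0 \<and> discr Q \<noteq> 0 \<and>
        (if even d then sigma d Q z F = discr Q ^ (d div 2) * F
         else (sigma d Q z F)\<^sup>2 = discr Q ^ d * F\<^sup>2)}"

end

theory Submission
  imports Defs
begin

text \<open>
  The quadratic form \<open>x\<^sub>1 x\<^sub>2\<close> has \<open>\<Delta> = 1\<close>, and the maps \<open>F \<mapsto> (Q\<^sup>r, F)\<^sub>r\<close> for \<open>Q = x\<^sub>1 x\<^sub>2\<close> are all diagonal in the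
  basis of monomials \<open>x\<^sub>1\<^sup>d\<^sup>-\<^sup>l x\<^sub>2\<^sup>l\<close>. Everything rests on one fact (lemma \<open>sigma_bimonom\<close>): for \<open>z = z(s)\<close> the eigenvalue of
  \<open>\<sigma>\<close> at this monomial is the sign \<open>s\<^sub>l\<close>. Then \<open>\<sigma>(F) = F\<close> says that \<open>F\<close> has no coefficient at an index with
  \<open>s\<^sub>l = -1\<close>. For odd \<open>d\<close> the equation \<open>\<sigma>(F)\<^sup>2 = F\<^sup>2\<close> means \<open>\<sigma>(F) = \<plusminus>F\<close>, because polynomials have no zero divisors.
  The equations are homogeneous in \<open>Q\<close> and \<open>F\<close>, so it does not matter which representatives of the
  two points are used (lemma \<open>locus_X1_X2_iff\<close>).

  The eigenvalue is a statement about Legendre polynomials. Encode a sequence \<open>c\<^sub>0, \<dots>, c\<^sub>d\<close> by the polynomial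
  \<open>\<Sum>\<^sub>l c\<^sub>l (d choose l) ((1 + x) / 2)\<^sup>l ((1 - x) / 2)\<^sup>d\<^sup>-\<^sup>l\<close>; by linear independence of the Bernstein polynomials it determines the
  sequence. The sequence of diagonal entries of \<open>F \<mapsto> (Q\<^sup>r, F)\<^sub>r\<close> is encoded by a multiple of the Legendre polynomial
  \<open>P\<^sub>r\<close> (lemma \<open>transvectant_sum_eq_coeff\<close>). So the \<open>z\<^sub>i\<close> for which \<open>\<sigma>\<close> has eigenvalues \<open>s\<^sub>l\<close> are, up to normalization, the
  Legendre coefficients of the polynomial \<open>S\<close> that encodes \<open>s\<close>, and the formula for \<open>z(s)\<close> computes exactly these. Its
  sums over \<open>l\<close>, \<open>p\<close>, \<open>q\<close> are the monomial coefficients of \<open>S\<close> (lemma \<open>zseq_sign_poly_coeff\<close>), and its remaining factorials are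
  the Legendre coefficients of the monomials (lemma \<open>power_legendre_expansion\<close>). Only \<open>P\<^sub>d\<^sub>-\<^sub>2\<^sub>i\<close> occur because the
  symmetry of a sign sequence gives \<open>S\<close> the parity of \<open>d\<close>.

  All polynomials in \<open>x\<close> are written in the variable \<open>t\<close> with \<open>x = (1 - t) / (1 + t)\<close> and multiplied by a power of
  \<open>1 + t\<close>. A Bernstein coefficient is then an ordinary coefficient, and no integration is needed: the Legendre
  expansion of \<open>x\<^sup>n\<close> follows by induction from the three-term recurrence.
\<close>

section \<open>Legendre expansion of a power\<close>

lemma of_nat_binomial_absorb:
  "of_nat (n - k) * of_nat (n choose k) =
   (of_nat (k + 1) * of_nat (n choose Suc k) :: 'a :: comm_semiring_1)"
  using binomial_absorption[of k n] binomial_absorb_comp[of n k]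
  by (simp only: of_nat_mult[symmetric]) (simp add: mult.commute)

lemma coeff_one_linear_power: "coeff ([:1, x:] ^ k) m = of_nat (k choose m) * x ^ m"
  for x :: complex
proof (cases "m \<le> k")
  case False
  have "degree ([:1, x:] ^ k) \<le> degree [:1, x:] * k" by (rule degree_power_le)
  also have "\<dots> \<le> k" by simp
  finally have "degree ([:1, x:] ^ k) < m" using False by simp
  then show ?thesis using False by (simp add: coeff_eq_0 binomial_eq_0)
qed (simp add: coeff_linear_poly_power)

text \<open>
  With \<open>P\<^sub>n\<close> the Legendre polynomial, this is \<open>(1 + t)\<^sup>n P\<^sub>n(x)\<close> for \<open>x = (1 - t) / (1 + t)\<close>, by the classical formula
  \<open>P\<^sub>n(x) = \<Sum>\<^sub>k (n choose k)\<^sup>2 ((x - 1) / 2)\<^sup>k ((x + 1) / 2)\<^sup>n\<^sup>-\<^sup>k\<close>. The variable \<open>t\<close> suits transvectants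
  because the Bernstein polynomial \<open>((1 + x) / 2)\<^sup>l ((1 - x) / 2)\<^sup>d\<^sup>-\<^sup>l\<close>, multiplied by \<open>(1 + t)\<^sup>d\<close>, is the single
  power \<open>t\<^sup>d\<^sup>-\<^sup>l\<close>.
\<close>

definition legendre :: "nat \<Rightarrow> complex poly" where
  "legendre n = (\<Sum>k\<le>n. monom ((-1) ^ k * of_nat (n choose k)^2) k)"

lemma coeff_legendre: "coeff (legendre n) k = (-1) ^ k * of_nat (n choose k)^2"
  by (auto simp: legendre_def coeff_sum sum.delta binomial_eq_0)

text \<open>
  The three-term recurrence of the Legendre polynomials, read off one coefficient at a time.
  Pascal's rule expresses every binomial coefficient through three neighbours \<open>a\<close>, \<open>b\<close>, \<open>c\<close> in row \<open>n\<close>;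
  the claim then reduces to one quadratic relation between them, which follows from the ratios
  \<open>a : b\<close> and \<open>b : c\<close>.
\<close>

lemma binomial_square_recurrence:
  fixes n :: nat
  defines "C \<equiv> \<lambda>n k. of_nat (n choose k) :: complex"
  shows "of_nat (2 * n + 3) * (C (Suc n) (Suc (Suc k))^2 + C (Suc n) (Suc k)^2) =
         of_nat (n + 2) * C (Suc (Suc n)) (Suc (Suc k))^2 +
         of_nat (n + 1) * (C n (Suc (Suc k))^2 - 2 * C n (Suc k)^2 + C n k^2)"
proof -
  define a b c where "a = C n k" and "b = C n (Suc k)" and "c = C n (Suc (Suc k))"
  have absorb: "of_nat (Suc j) * C n (Suc j) = (of_nat n - of_nat j) * C n j" for j
    using of_nat_binomial_absorb[of n j, where 'a = complex] unfolding C_def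
    by (cases "j \<le> n") (simp_all add: of_nat_diff algebra_simps binomial_eq_0)
  have ab: "(of_nat k + 1) * b = (of_nat n - of_nat k) * a"
    using absorb[of k] by (simp add: a_def b_def algebra_simps)
  have bc: "(of_nat k + 2) * c = (of_nat n - of_nat k - 1) * b"
    using absorb[of "Suc k"] by (simp add: c_def b_def algebra_simps)
  have key: "of_nat n * b^2 = a * b + b * c + (of_nat n + 2) * a * c"
  proof -
    have "(of_nat k + 1) * (of_nat k + 2) * (of_nat n * b^2) =
          (of_nat k + 1) * (of_nat k + 2) * (a * b + b * c + (of_nat n + 2) * a * c)"
      using ab bc by algebra
    moreover have "(of_nat k + 1 :: complex) \<noteq> 0" "(of_nat k + 2 :: complex) \<noteq> 0"
      using of_nat_neq_0[where 'a = complex, of k] of_nat_neq_0[where 'a = complex, of "Suc k"]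
      by (simp_all add: add_ac)
    ultimately show ?thesis by simp
  qed
  have p: "C (Suc n) (Suc k) = a + b" "C (Suc n) (Suc (Suc k)) = b + c"
    "C (Suc (Suc n)) (Suc (Suc k)) = a + 2 * b + c"
    by (simp_all add: C_def a_def b_def c_def)
  show ?thesis
    unfolding p a_def[symmetric] b_def[symmetric] c_def[symmetric] of_nat_add of_nat_mult of_nat_numeral of_nat_1
    using key by algebra
qed

text \<open>
  This is \<open>(2n + 1) x P\<^sub>n = (n + 1) P\<^sub>n\<^sub>+\<^sub>1 + n P\<^sub>n\<^sub>-\<^sub>1\<close> after clearing the denominators \<open>1 + t\<close>, with \<open>n + 1\<close> in place
  of \<open>n\<close>.
\<close>

lemma legendre_recurrence:
  "smult (of_nat (2 * n + 3)) ([:1, -1:] * legendre (Suc n)) =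
   smult (of_nat (n + 2)) (legendre (Suc (Suc n))) +
   smult (of_nat (n + 1)) ([:1, 1:]^2 * legendre n)"
proof (rule poly_eqI)
  fix k
  have sq: "[:1, 1:]^2 = [:1, 2, 1 :: complex:]" by (simp add: power2_eq_square)
  consider "k = 0" | "k = 1" | j where "k = Suc (Suc j)"
    by (metis One_nat_def not0_implies_Suc)
  then show "coeff (smult (of_nat (2 * n + 3)) ([:1, -1:] * legendre (Suc n))) k =
     coeff (smult (of_nat (n + 2)) (legendre (Suc (Suc n))) +
       smult (of_nat (n + 1)) ([:1, 1:]^2 * legendre n)) k"
  proof cases
    case 3
    show ?thesis unfolding sq
      using arg_cong[OF binomial_square_recurrence[of n j], of "\<lambda>x. (-1) ^ j * x"]
      by (simp add: 3 coeff_legendre coeff_pCons algebra_simps del: binomial_Suc_Suc)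
  qed (simp_all add: sq coeff_legendre coeff_pCons algebra_simps power2_eq_square)
qed

lemma legendre_recurrence_shift:
  "smult (of_nat (2 * n + 1)) ([:1, -1:] * legendre n) =
   smult (of_nat (n + 1)) (legendre (Suc n)) +
   smult (of_nat n) ([:1, 1:]^2 * legendre (n - 1))"
proof (cases n)
  case 0
  then show ?thesis by (auto simp: legendre_def one_pCons monom_altdef)
next
  case (Suc m)
  then show ?thesis using legendre_recurrence[of m] by (simp add: algebra_simps)
qed

text \<open>
  The moment \<open>\<onehalf> \<integral> x\<^sup>n P\<^sub>n\<^sub>-\<^sub>2\<^sub>j(x) dx\<close> over \<open>[-1, 1]\<close>, for \<open>2j \<le> n\<close>. In \<^const>\<open>zseq\<close> the quotient
  \<open>(d - 2e)! (d - i - e)! / ((2d - 2i - 2e + 1)! (i - e)!)\<close> is this moment for \<open>n = d - 2e\<close> and \<open>j = i - e\<close>, divided by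
  \<open>2\<^sup>d\<^sup>-\<^sup>2\<^sup>i\<close>.
\<close>

definition legendre_coeff :: "nat \<Rightarrow> nat \<Rightarrow> complex" where
  "legendre_coeff n j =
     fact n * fact (n - j) * 2 ^ (n - 2 * j) / (fact j * fact (2 * n - 2 * j + 1))"

text \<open>
  The recurrence for the moments that comes from integrating the Legendre recurrence against \<open>x\<^sup>n\<close>.
  It is stated for \<open>n = 2j + m + 2\<close>, so that no subtraction is truncated; the two lemmas after it are the ends of
  the range, where one of the three terms is missing.
\<close>

lemma legendre_coeff_Suc:
  "of_nat (m + 1) * legendre_coeff (2 * j + m + 2) (Suc j) +
   of_nat (m + 2) * legendre_coeff (2 * j + m + 2) j =
   of_nat (2 * m + 3) * legendre_coeff (2 * j + m + 3) (Suc j)"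
proof -
  define A where "A = (fact (2 * j + m + 2) :: complex)"
  define B where "B = (fact (j + m + 1) :: complex)"
  define D where "D = (fact (2 * j + 2 * m + 3) :: complex)"
  define E where "E = (fact j :: complex)"
  define J M where "J = (of_nat j :: complex)" and "M = (of_nat m :: complex)"
  have f: "fact (2 * j + m + 3) = (2 * J + M + 3) * A"
    "fact (j + m + 2) = (J + M + 2) * B"
    "fact (2 * j + 2 * m + 5) = (2 * J + 2 * M + 5) * (2 * J + 2 * M + 4) * D"
    "fact (Suc j) = (J + 1) * E"
    by (simp_all add: eval_nat_numeral algebra_simps A_def B_def D_def E_def J_def M_def)
  have [simp]: "2 * J + 2 * M + 5 \<noteq> 0" "2 * J + 2 * M + 4 \<noteq> 0" "J + 1 \<noteq> 0" "D \<noteq> 0" "E \<noteq> 0"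
    using of_nat_neq_0[where 'a=complex, of "2*j+2*m+4"] of_nat_neq_0[where 'a=complex, of "2*j+2*m+3"]
      of_nat_neq_0[where 'a=complex, of j]
    by (simp_all add: algebra_simps D_def E_def J_def M_def)
  have i: "2 * j + m + 2 - Suc j = j + m + 1" "2 * j + m + 2 - 2 * Suc j = m"
    "2 * (2 * j + m + 2) - 2 * Suc j + 1 = 2 * j + 2 * m + 3"
    "2 * j + m + 2 - j = j + m + 2" "2 * j + m + 2 - 2 * j = m + 2"
    "2 * (2 * j + m + 2) - 2 * j + 1 = 2 * j + 2 * m + 5"
    "2 * j + m + 3 - Suc j = j + m + 2" "2 * j + m + 3 - 2 * Suc j = m + 1"
    "2 * (2 * j + m + 3) - 2 * Suc j + 1 = 2 * j + 2 * m + 5"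
    by simp_all
  define W where "W = A * B * 2 ^ m / ((J + 1) * E * ((2*J+2*M+5) * (2*J+2*M+4) * D))"
  have L: "legendre_coeff (2 * j + m + 2) (Suc j) = W * ((2*J+2*M+5) * (2*J+2*M+4))"
    "legendre_coeff (2 * j + m + 2) j = W * (4 * (J + M + 2) * (J + 1))"
    "legendre_coeff (2 * j + m + 3) (Suc j) = W * (2 * (2 * J + M + 3) * (J + M + 2))"
    unfolding legendre_coeff_def i f A_def[symmetric] B_def[symmetric] D_def[symmetric] E_def[symmetric] W_def
    by (simp_all add: divide_simps power_add)
  have "(M + 1) * (W * ((2*J+2*M+5) * (2*J+2*M+4))) + (M + 2) * (W * (4 * (J + M + 2) * (J + 1)))
    = (2 * M + 3) * (W * (2 * (2 * J + M + 3) * (J + M + 2)))" by algebra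
  then show ?thesis unfolding L by (simp add: M_def add_ac)
qed

lemma legendre_coeff_Suc_boundary:
  "legendre_coeff (2 * j + 1) j = legendre_coeff (2 * j + 2) (Suc j)"
proof -
  have i: "2 * j + 1 - j = j + 1" "2 * (2 * j + 1) - 2 * j + 1 = 2 * j + 3"
    "2 * j + 1 - 2 * j = 1" "2 * j + 2 - Suc j = j + 1" "2 * j + 2 - 2 * Suc j = 0"
    "2 * (2 * j + 2) - 2 * Suc j + 1 = 2 * j + 3" by simp_all
  have "(of_nat j + 1 :: complex) \<noteq> 0" using of_nat_neq_0[where 'a=complex, of j] by (simp add: algebra_simps)
  then show ?thesis unfolding legendre_coeff_def i by (simp add: divide_simps) (simp add: algebra_simps)
qed

lemma legendre_coeff_Suc_0:
  "of_nat (n + 1) * legendre_coeff n 0 = of_nat (2 * n + 3) * legendre_coeff (Suc n) 0"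
proof -
  have "(of_nat n + 1 :: complex) \<noteq> 0" "(2 * of_nat n + 2 :: complex) \<noteq> 0" "(2 * of_nat n + 3 :: complex) \<noteq> 0"
    using of_nat_neq_0[where 'a=complex, of n] of_nat_neq_0[where 'a=complex, of "2*n+1"]
     of_nat_neq_0[where 'a=complex, of "2*n+2"] by (simp_all add: algebra_simps)
  then show ?thesis
   unfolding legendre_coeff_def by (simp add: divide_simps) (simp add: algebra_simps)
qed

text \<open>
  The Legendre expansion of \<open>x\<^sup>n\<close>, multiplied by \<open>(1 + t)\<^sup>n\<close>. Multiplying the expansion for \<open>n\<close> by
  \<open>x\<close> and applying the Legendre recurrence to each term gives the one for \<open>n + 1\<close>.
\<close>

lemma power_legendre_expansion:
  "[:1, -1:] ^ n =
   (\<Sum>j\<le>n div 2. smult (of_nat (2 * (n - 2 * j) + 1) * legendre_coeff n j)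
      ([:1, 1:] ^ (2 * j) * legendre (n - 2 * j)))"
proof (induction n)
  case 0
  show ?case by (simp add: legendre_coeff_def legendre_def one_pCons monom_altdef)
next
  case (Suc n)
  \<comment> \<open>Extending the moments by zero lets all sums run over \<open>j \<le> n\<close>, so that the index shift needs no parity cases.\<close>
  define b where "b n j = (if 2 * j \<le> n then legendre_coeff n j else 0)" for n j
  define T where "T n j = [:1, 1:] ^ (2 * j) * legendre (n - 2 * j)" for n j
  have ext: "(\<Sum>j\<le>n div 2. smult (of_nat (2 * (n - 2 * j) + 1) * legendre_coeff n j) (T n j)) =
    (\<Sum>j\<le>n. smult (of_nat (2 * (n - 2 * j) + 1) * b n j) (T n j))" for n
    by (rule sum.mono_neutral_cong_left) (auto simp: b_def)
  have step: "smult (of_nat (2 * (n - 2 * j) + 1) * b n j) ([:1, -1:] * T n j) =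
     smult (of_nat (n - 2 * j + 1) * b n j) (T (Suc n) j) +
     smult (of_nat (n - 2 * j) * b n j) (T (Suc n) (Suc j))" for j
  proof (cases "2 * j \<le> n")
    case True
    have i: "Suc n - 2 * j = Suc (n - 2 * j)" "Suc n - 2 * Suc j = n - 2 * j - 1"
      "[:1, 1:] ^ (2 * Suc j) = ([:1, 1:] ^ (2 * j) * [:1, 1:]^2 :: complex poly)"
      using True power_add[of "[:1, 1:] :: complex poly" "2 * j" 2]
      by (simp_all only: Suc_diff_le mult_Suc_right add.commute[of 2])
    have "smult (of_nat (2 * (n - 2 * j) + 1) * b n j) ([:1, -1:] * T n j) =
      smult (b n j) ([:1, 1:] ^ (2 * j) * smult (of_nat (2 * (n - 2 * j) + 1)) ([:1, -1:] * legendre (n - 2 * j)))"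
      by (simp only: T_def mult_ac mult_smult_right smult_smult)
    also have "\<dots> = smult (of_nat (n - 2 * j + 1) * b n j) (T (Suc n) j) +
     smult (of_nat (n - 2 * j) * b n j) (T (Suc n) (Suc j))"
      unfolding legendre_recurrence_shift
      by (simp only: T_def i) (simp only: distrib_left smult_add_right mult_smult_right smult_smult mult_ac)
    finally show ?thesis .
  qed (simp add: b_def)
  have coeffs: "of_nat (n - 2 * Suc j + 1) * b n (Suc j) + of_nat (n - 2 * j) * b n j =
     of_nat (2 * (Suc n - 2 * Suc j) + 1) * b (Suc n) (Suc j)" for j
  proof -
    have "(\<exists>m. n = 2 * j + m + 2) \<or> n = 2 * j + 1 \<or> n \<le> 2 * j" by presburger
    then consider m where "n = 2 * j + m + 2" | "n = 2 * j + 1" | "n \<le> 2 * j" by blast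
    then show ?thesis
    proof cases
      case (1 m)
      then show ?thesis using legendre_coeff_Suc[of m j] by (simp add: b_def eval_nat_numeral add_ac)
    next
      case 2
      then show ?thesis using legendre_coeff_Suc_boundary[of j] by (simp add: b_def)
    qed (auto simp: b_def)
  qed
  have coeff0: "of_nat (n + 1) * b n 0 = of_nat (2 * Suc n + 1) * b (Suc n) 0"
    using legendre_coeff_Suc_0[of n] by (simp add: b_def)
  have "[:1, -1:] ^ Suc n = (\<Sum>j\<le>n. smult (of_nat (2 * (n - 2 * j) + 1) * b n j) ([:1, -1:] * T n j))"
    unfolding power_Suc Suc.IH T_def[symmetric] ext
    by (simp add: sum_distrib_left mult_ac)
  also have "\<dots> = (\<Sum>j\<le>n. smult (of_nat (n - 2 * j + 1) * b n j) (T (Suc n) j)) +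
     (\<Sum>j\<le>n. smult (of_nat (n - 2 * j) * b n j) (T (Suc n) (Suc j)))"
    by (simp only: step sum.distrib)
  also have "(\<Sum>j\<le>n. smult (of_nat (n - 2 * j + 1) * b n j) (T (Suc n) j)) =
    (\<Sum>j\<le>Suc n. smult (of_nat (n - 2 * j + 1) * b n j) (T (Suc n) j))"
    by (simp add: b_def)
  also have "\<dots> = smult (of_nat (n + 1) * b n 0) (T (Suc n) 0) +
     (\<Sum>j\<le>n. smult (of_nat (n - 2 * Suc j + 1) * b n (Suc j)) (T (Suc n) (Suc j)))"
    by (subst sum.atMost_Suc_shift) simp
  finally have "[:1, -1:] ^ Suc n = smult (of_nat (n + 1) * b n 0) (T (Suc n) 0) +
    (\<Sum>j\<le>n. smult (of_nat (2 * (Suc n - 2 * Suc j) + 1) * b (Suc n) (Suc j)) (T (Suc n) (Suc j)))"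
    unfolding add.assoc sum.distrib[symmetric] smult_add_left[symmetric] coeffs .
  also have "\<dots> = (\<Sum>j\<le>Suc n. smult (of_nat (2 * (Suc n - 2 * j) + 1) * b (Suc n) j) (T (Suc n) j))"
    unfolding coeff0 sum.atMost_Suc_shift by simp
  finally show ?case using ext[of "Suc n"] by (simp only: T_def)
qed
section \<open>Transvectants with powers of \<open>x\<^sub>1 x\<^sub>2\<close>\<close>

definition bimonom :: "nat \<Rightarrow> nat \<Rightarrow> bipoly" where
  "bimonom a b = monom (monom 1 b) a"

lemma coeff_bimonom: "coeff (coeff (bimonom a b) i) j = (if i = a \<and> j = b then 1 else 0)"
  by (simp add: bimonom_def)

lemma coeff_cscale: "coeff (coeff (cscale c A) i) j = c * coeff (coeff A i) j"
  by (simp add: cscale_def)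

lemma cscale_bimonom: "cscale c (bimonom a b) = monom (monom c b) a"
  by (simp add: cscale_def bimonom_def smult_monom)

lemma bimonom_mult: "bimonom a b * bimonom c e = bimonom (a + c) (b + e)"
  by (simp add: bimonom_def mult_monom)

lemma X1_X2_power: "X1 ^ a * X2 ^ b = bimonom a b"
  unfolding X1_def X2_def bimonom_def
  by (simp add: monom_altdef poly_const_pow mult.commute)

lemma cscale_mult_left: "cscale c A * B = cscale c (A * B)"
  and cscale_mult_right: "A * cscale c B = cscale c (A * B)"
  by (simp_all add: cscale_def)

lemma cscale_power: "cscale c A ^ n = cscale (c ^ n) (A ^ n)"
  by (simp add: cscale_def smult_power poly_const_pow)

lemma D1_funpow_add: "(D1 ^^ n) (A + B) = (D1 ^^ n) A + (D1 ^^ n) B"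
  by (induction n) (simp_all add: D1_def pderiv_add)

lemma D1_funpow_cscale: "(D1 ^^ n) (cscale c A) = cscale c ((D1 ^^ n) A)"
  by (induction n) (simp_all add: D1_def cscale_def pderiv_smult)

lemma D2_add: "D2 (A + B) = D2 A + D2 B"
  by (simp add: D2_def poly_eq_iff[of "map_poly _ _"] coeff_map_poly pderiv_add)

lemma D2_cscale: "D2 (cscale c A) = cscale c (D2 A)"
  by (simp add: D2_def cscale_def poly_eq_iff[of "map_poly _ _"] coeff_map_poly pderiv_smult)

lemma D2_funpow_add: "(D2 ^^ n) (A + B) = (D2 ^^ n) A + (D2 ^^ n) B"
  by (induction n) (simp_all add: D2_add)

lemma D2_funpow_cscale: "(D2 ^^ n) (cscale c A) = cscale c ((D2 ^^ n) A)"
  by (induction n) (simp_all add: D2_cscale)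

lemma D1_funpow_bimonom:
  "(D1 ^^ n) (bimonom a b) = cscale (fact n * of_nat (a choose n)) (bimonom (a - n) b)"
proof (induction n)
  case (Suc n)
  then show ?case using of_nat_binomial_absorb[of a n, where 'a = complex]
    by (simp add: D1_def cscale_bimonom pderiv_monom of_nat_poly smult_monom)
qed simp

lemma D2_funpow_bimonom:
  "(D2 ^^ n) (bimonom a b) = cscale (fact n * of_nat (b choose n)) (bimonom a (b - n))"
proof (induction n)
  case (Suc n)
  then show ?case using of_nat_binomial_absorb[of b n, where 'a = complex]
    by (simp add: D2_def cscale_bimonom pderiv_monom map_poly_monom)
qed simp

lemma transvectant_add_right:
  "transvectant m k r A (B + C) = transvectant m k r A B + transvectant m k r A C"
  by (simp add: transvectant_def D1_funpow_add D2_funpow_add distrib_left bipoly.scale_right_distrib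
      sum.distrib)

lemma transvectant_cscale_right:
  "transvectant m k r A (cscale c B) = cscale c (transvectant m k r A B)"
  by (simp add: transvectant_def D1_funpow_cscale D2_funpow_cscale cscale_mult_right
      bipoly.scale_sum_right) (simp add: mult_ac)

lemma transvectant_cscale_left:
  "transvectant m k r (cscale c A) B = cscale c (transvectant m k r A B)"
  by (simp add: transvectant_def D1_funpow_cscale D2_funpow_cscale cscale_mult_left
      bipoly.scale_sum_right) (simp add: mult_ac)

lemma discr_cscale: "discr (cscale c Q) = cscale (c^2) (discr Q)"
  by (simp add: discr_def transvectant_cscale_left transvectant_cscale_right power2_eq_square mult_ac)

lemma discr_X1_X2: "discr (X1 * X2) = 1"
proof -
  have "X1 * X2 = bimonom 1 1" using X1_X2_power[of 1 1] by simp
  then show ?thesis unfolding discr_def transvectant_def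
    by (simp add: D1_funpow_bimonom D2_funpow_bimonom D1_funpow_cscale D2_funpow_cscale
       cscale_mult_left cscale_mult_right bimonom_mult atMost_Suc numeral_2_eq_2 del: funpow.simps)
     (simp add: cscale_def bimonom_def one_pCons monom_altdef)
qed

lemma sigma_linear: "Vector_Spaces.linear cscale cscale (sigma d Q z)"
  by unfold_locales
    (simp_all add: sigma_def transvectant_add_right transvectant_cscale_right distrib_left
      cscale_mult_right bipoly.scale_right_distrib sum.distrib bipoly.scale_sum_right mult_ac)

lemma sigma_cscale_left: "sigma d (cscale c Q) z F = cscale (c ^ d) (sigma d Q z F)"
  unfolding sigma_def bipoly.scale_sum_right
proof (intro sum.cong refl, goal_cases)
  case (1 i)
  then have "d = 2 * i + (d - 2 * i)" by simp
  then have "c ^ d = (c^2) ^ i * c ^ (d - 2 * i)" by (metis power_add power_mult)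
  then show ?case
    by (simp add: discr_cscale cscale_power transvectant_cscale_left cscale_mult_left cscale_mult_right)
qed

text \<open>
  Each summand of \<open>((x\<^sub>1 x\<^sub>2)\<^sup>r, x\<^sub>1\<^sup>d\<^sup>-\<^sup>l x\<^sub>2\<^sup>l)\<^sub>r\<close> differentiates the product of the two monomials \<open>r\<close> times in each
  variable, so the result is a multiple of the second monomial: transvection with powers of \<open>x\<^sub>1 x\<^sub>2\<close> is
  diagonal in the monomial basis.
\<close>

lemma transvectant_bimonom:
  assumes "r \<le> d" "l \<le> d"
  shows "transvectant (2 * r) d r (bimonom r r) (bimonom (d - l) l) =
    cscale (fact r ^ 3 * fact (d - r) / (fact (2 * r) * fact d) *
      (\<Sum>k\<le>r. (-1) ^ k * of_nat (r choose k) * of_nat (l choose (r - k)) * of_nat ((d - l) choose k)))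
      (bimonom (d - l) l)"
proof -
  have *: "cscale ((-1) ^ k * of_nat (r choose k))
       ((D1 ^^ (r - k)) ((D2 ^^ k) (bimonom r r)) * (D2 ^^ (r - k)) ((D1 ^^ k) (bimonom (d - l) l))) =
     cscale (fact r ^ 2 * ((-1) ^ k * of_nat (r choose k) * of_nat (l choose (r - k)) * of_nat ((d - l) choose k)))
       (bimonom (d - l) l)" if "k \<le> r" for k
    \<comment> \<open>Outside this range a derivative vanishes, and the exponents on the left are truncated differences.\<close>
  proof (cases "k \<le> d - l \<and> r - k \<le> l")
    case True
    have sym: "r choose (r - k) = r choose k" using that by (simp add: binomial_symmetric[symmetric])
    have fr: "fact (r - k) * fact k * of_nat (r choose k) = (fact r :: complex)"
      using that by (simp add: binomial_fact)
    have const: "S * of_nat (r choose k) * (fact k * M * (fact (r - k) * N) *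
        (fact k * of_nat (r choose k) * (fact (r - k) * of_nat (r choose k)))) =
      (fact r)\<^sup>2 * (S * of_nat (r choose k) * N * M)"
      for S N M :: complex
      unfolding fr[symmetric] by algebra
    have "r - (r - k) + (d - l - k) = d - l" "r - k + (l - (r - k)) = l"
      using that True by auto
    then show ?thesis
      by (simp only: D1_funpow_bimonom D2_funpow_bimonom D1_funpow_cscale D2_funpow_cscale
       cscale_mult_left cscale_mult_right bimonom_mult bipoly.scale_scale sym const)
  next
    case False
    then have "l choose (r - k) = 0 \<or> (d - l) choose k = 0"
      by (auto simp: binomial_eq_0)
    then show ?thesis
      by (auto simp add: binomial_eq_0 D1_funpow_bimonom D2_funpow_bimonom D1_funpow_cscale D2_funpow_cscale
       cscale_mult_left cscale_mult_right bimonom_mult)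
  qed
  have "fact (2 * r - r) = (fact r :: complex)" by simp
  then show ?thesis
    unfolding transvectant_def
    by (simp add: * bipoly.scale_sum_left[symmetric] sum_distrib_left[symmetric] power2_eq_square power3_eq_cube)
qed

lemma form_expansion:
  assumes "F \<in> forms d"
  shows "F = (\<Sum>l\<le>d. cscale (coeff (coeff F (d - l)) l) (bimonom (d - l) l))"
proof (intro poly_eqI)
  fix i j
  have "coeff (coeff (\<Sum>l\<le>d. cscale (coeff (coeff F (d - l)) l) (bimonom (d - l) l)) i) j =
     (\<Sum>l\<le>d. if l = j then (if i + j = d then coeff (coeff F i) j else 0) else 0)"
    unfolding coeff_sum
    by (intro sum.cong refl) (auto simp: coeff_cscale coeff_bimonom)
  also have "\<dots> = coeff (coeff F i) j"
    using assms by (auto simp: forms_def)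
  finally show "coeff (coeff F i) j =
     coeff (coeff (\<Sum>l\<le>d. cscale (coeff (coeff F (d - l)) l) (bimonom (d - l) l)) i) j" ..
qed

text \<open>
  Up to factors free of \<open>k\<close>, regrouping the factorials turns the product of the two binomial coefficients that
  depend on \<open>l\<close> into \<open>(r choose k) (d - r choose d - l - k)\<close>, and the sum over \<open>k\<close> becomes a
  convolution. Hence the diagonal entries of the transvection are, up to factorials, the Bernstein coefficients
  of \<open>P\<^sub>r\<close> in degree \<open>d\<close>.
\<close>

lemma transvectant_sum_eq_coeff:
  assumes "r \<le> d" "l \<le> d"
  shows "fact (d - r) * fact r *
      (\<Sum>k\<le>r. (-1) ^ k * of_nat (r choose k) * of_nat (l choose (r - k)) * of_nat ((d - l) choose k)) =
     fact l * fact (d - l) * coeff ([:1, 1:] ^ (d - r) * legendre r) (d - l)"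
proof -
  have *: "fact (d - r) * fact r * of_nat (l choose (r - k)) * of_nat ((d - l) choose k) =
     (fact l * fact (d - l) * of_nat (r choose k) * of_nat ((d - r) choose (d - l - k)) :: complex)"
    if "k \<le> r" "k \<le> d - l" for k
  proof (cases "r - k \<le> l")
    case True
    have "d - r - (d - l - k) = l - (r - k)" "d - l - k \<le> d - r" "r - k \<le> l"
      using that True assms by auto
    then show ?thesis using that by (simp add: binomial_fact mult_ac)
  next
    case False
    then show ?thesis using assms that by (simp add: binomial_eq_0)
  qed
  have "coeff ([:1, 1:] ^ (d - r) * legendre r) (d - l) =
     (\<Sum>k\<le>d - l. coeff (legendre r) k * coeff ([:1, 1:] ^ (d - r)) (d - l - k))"
    by (subst mult.commute) (rule coeff_mult)
  also have "\<dots> = (\<Sum>k\<le>d - l. (-1) ^ k * of_nat (r choose k)^2 * of_nat ((d - r) choose (d - l - k)))"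
  proof (intro sum.cong refl)
    fix k
    show "coeff (legendre r) k * coeff ([:1, 1:] ^ (d - r)) (d - l - k) =
       (-1) ^ k * of_nat (r choose k)^2 * of_nat ((d - r) choose (d - l - k))"
      by (simp add: coeff_legendre coeff_one_linear_power)
  qed
  finally have "fact l * fact (d - l) * coeff ([:1, 1:] ^ (d - r) * legendre r) (d - l) =
     (\<Sum>k\<le>d - l. fact l * fact (d - l) * ((-1) ^ k * of_nat (r choose k)^2 * of_nat ((d - r) choose (d - l - k))))"
    by (simp add: sum_distrib_left)
  also have "\<dots> = (\<Sum>k\<in>{..r} \<inter> {..d - l}. fact l * fact (d - l) * ((-1) ^ k * of_nat (r choose k)^2 * of_nat ((d - r) choose (d - l - k))))"
    by (rule sum.mono_neutral_right) (auto simp: binomial_eq_0)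
  also have "\<dots> = (\<Sum>k\<in>{..r} \<inter> {..d - l}. fact (d - r) * fact r *
     ((-1) ^ k * of_nat (r choose k) * of_nat (l choose (r - k)) * of_nat ((d - l) choose k)))"
  proof (intro sum.cong refl)
    fix k assume "k \<in> {..r} \<inter> {..d - l}"
    then show "fact l * fact (d - l) * ((-1) ^ k * of_nat (r choose k)^2 * of_nat ((d - r) choose (d - l - k))) =
       (fact (d - r) * fact r *
     ((-1) ^ k * of_nat (r choose k) * of_nat (l choose (r - k)) * of_nat ((d - l) choose k)) :: complex)"
      using *[of k] by (simp add: power2_eq_square mult_ac)
  qed
  also have "\<dots> = (\<Sum>k\<le>r. fact (d - r) * fact r *
     ((-1) ^ k * of_nat (r choose k) * of_nat (l choose (r - k)) * of_nat ((d - l) choose k)))"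
    by (rule sum.mono_neutral_left) (auto simp: binomial_eq_0)
  finally show ?thesis by (simp add: sum_distrib_left)
qed
section \<open>The polynomial with given Bernstein coefficients\<close>

lemma coeff_power_mult_power:
  "coeff ([:1, 1:] ^ a * [:1, -1:] ^ b) n =
   (\<Sum>(p, q) | p \<le> a \<and> q \<le> b \<and> p + q = n. (-1) ^ q * of_nat (a choose p) * of_nat (b choose q) :: complex)"
proof -
  have "coeff ([:1, 1:] ^ a * [:1, -1:] ^ b) n =
    (\<Sum>p\<le>n. of_nat (a choose p) * (of_nat (b choose (n - p)) * (-1) ^ (n - p)) :: complex)"
    by (simp add: coeff_mult coeff_one_linear_power)
  also have "\<dots> = (\<Sum>(p, q) | p + q = n. (-1) ^ q * of_nat (a choose p) * of_nat (b choose q))"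
    by (rule sum.reindex_bij_witness[of _ fst "\<lambda>p. (p, n - p)"]) (auto simp: mult_ac)
  also have "\<dots> = (\<Sum>(p, q) | p \<le> a \<and> q \<le> b \<and> p + q = n. (-1) ^ q * of_nat (a choose p) * of_nat (b choose q))"
    by (rule sum.mono_neutral_right)
      (auto simp: not_le binomial_eq_0 intro: finite_subset[of _ "{..n} \<times> {..n}"])
  finally show ?thesis .
qed

text \<open>
  The homogenization \<open>\<Sum>\<^sub>j p\<^sub>j A\<^sup>j B\<^sup>N\<^sup>-\<^sup>j\<close> of a polynomial \<open>p\<close> is multiplicative. Multiplying by one linear factor at a
  time is enough here.
\<close>

lemma homogenization_linear_product:
  fixes A B :: "'a :: comm_ring_1 poly"
  assumes "degree p \<le> N"
  shows "(\<Sum>j\<le>Suc N. smult (coeff ([:1, c:] * p) j) (A ^ j * B ^ (Suc N - j))) =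
    (B + smult c A) * (\<Sum>j\<le>N. smult (coeff p j) (A ^ j * B ^ (N - j)))"
proof -
  have "(\<Sum>j\<le>Suc N. smult (coeff ([:1, c:] * p) j) (A ^ j * B ^ (Suc N - j))) =
     (\<Sum>j\<le>Suc N. smult (coeff p j) (A ^ j * B ^ (Suc N - j))) +
     (\<Sum>j\<le>Suc N. smult (case j of 0 \<Rightarrow> 0 | Suc i \<Rightarrow> c * coeff p i) (A ^ j * B ^ (Suc N - j)))"
    unfolding sum.distrib[symmetric]
    by (intro sum.cong refl) (auto simp: coeff_pCons smult_add_left split: nat.split)
  also have "(\<Sum>j\<le>Suc N. smult (coeff p j) (A ^ j * B ^ (Suc N - j))) =
      B * (\<Sum>j\<le>N. smult (coeff p j) (A ^ j * B ^ (N - j)))"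
    using assms by (simp add: coeff_eq_0 sum_distrib_left Suc_diff_le mult_ac)
  also have "(\<Sum>j\<le>Suc N. smult (case j of 0 \<Rightarrow> 0 | Suc i \<Rightarrow> c * coeff p i) (A ^ j * B ^ (Suc N - j))) =
      smult c A * (\<Sum>j\<le>N. smult (coeff p j) (A ^ j * B ^ (N - j)))"
    by (subst sum.atMost_Suc_shift, unfold sum_distrib_left) (simp add: mult_ac)
  finally show ?thesis by (simp add: distrib_right)
qed

lemma homogenization_power_product:
  fixes A B :: "complex poly"
  shows "(\<Sum>j\<le>a + b. smult (coeff ([:1, 1:] ^ a * [:1, -1:] ^ b) j) (A ^ j * B ^ (a + b - j))) =
    (B + A) ^ a * (B - A) ^ b"
proof (induction a)
  case 0
  show ?case
  proof (induction b)
    case (Suc b)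
    have "degree ([:1, -1 :: complex:] ^ b) \<le> b"
      using degree_power_le[of "[:1, -1 :: complex:]" b] by simp
    from homogenization_linear_product[OF this, of "-1" A B] Suc show ?case by (simp add: mult_ac)
  qed simp
next
  case (Suc a)
  have "degree ([:1, 1 :: complex:] ^ a * [:1, -1 :: complex:] ^ b) \<le> a + b"
    using degree_power_le[of "[:1, -1 :: complex:]" b] degree_power_le[of "[:1, 1 :: complex:]" a]
    by (intro order.trans[OF degree_mult_le]) simp
  from homogenization_linear_product[OF this, of 1 A B] Suc show ?case by (simp only: power_Suc mult_ac add_Suc smult_1_left)
qed

text \<open>
  The coefficient of \<open>y\<^sup>n\<close> in \<open>\<Sum>\<^sub>l s\<^sub>l (1 + y)\<^sup>l (1 - y)\<^sup>d\<^sup>-\<^sup>l / (l! (d - l)!)\<close>. Multiplied by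
  \<open>d! / 2\<^sup>d\<close>, that sum is the polynomial whose Bernstein coefficients are the signs \<open>s\<^sub>l\<close>.
\<close>

definition sign_poly_coeff :: "nat \<Rightarrow> (nat \<Rightarrow> int) \<Rightarrow> nat \<Rightarrow> complex" where
  "sign_poly_coeff d s n =
     (\<Sum>l\<le>d. of_int (s l) / (fact l * fact (d - l)) * coeff ([:1, 1:] ^ l * [:1, -1:] ^ (d - l)) n)"

lemma coeff_reflect:
  "coeff ([:1, 1:] ^ a * [:1, -1:] ^ b) n = (-1) ^ n * coeff ([:1, 1:] ^ b * [:1, -1 :: complex:] ^ a) n"
proof -
  have "coeff ([:1, 1:] ^ a * [:1, -1 :: complex:] ^ b) n =
     (\<Sum>(p, q) | p \<le> b \<and> q \<le> a \<and> p + q = n. (-1) ^ n * ((-1) ^ q * of_nat (b choose p) * of_nat (a choose q)))"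
    unfolding coeff_power_mult_power
    by (rule sum.reindex_bij_witness[of _ "\<lambda>(p, q). (q, p)" "\<lambda>(p, q). (q, p)"])
       (auto simp: power_add mult_ac simp flip: power_mult_distrib)
  then show ?thesis unfolding coeff_power_mult_power by (simp add: sum_distrib_left case_prod_beta)
qed

text \<open>
  This explains the weights \<open>m\<^sub>l\<close>: they make the sum over half of the range count a possible middle term
  once and not twice.
\<close>

lemma sum_half_weight:
  fixes f :: "nat \<Rightarrow> complex"
  assumes "\<And>l. l \<le> d \<Longrightarrow> f (d - l) = f l"
  shows "2 * (\<Sum>l\<le>d div 2. half_weight d l * f l) = (\<Sum>l\<le>d. f l)"
proof -
  have "(\<Sum>l\<le>d. f l) = (\<Sum>l\<in>{..d div 2} \<union> {d div 2<..d}. f l)"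
    by (rule sum.cong) auto
  also have "\<dots> = (\<Sum>l\<le>d div 2. f l) + (\<Sum>l\<in>{d div 2<..d}. f l)"
    by (rule sum.union_disjoint) auto
  also have "(\<Sum>l\<in>{d div 2<..d}. f l) = (\<Sum>l | 2 * l < d. f l)"
    by (rule sum.reindex_bij_witness[of _ "\<lambda>l. d - l" "\<lambda>l. d - l"]) (auto simp: assms)
  also have "\<dots> = (\<Sum>l\<le>d div 2. if 2 * l < d then f l else 0)"
    by (rule sum.mono_neutral_cong_left) auto
  also have "(\<Sum>l\<le>d div 2. f l) + \<dots> = (\<Sum>l\<le>d div 2. 2 * (half_weight d l * f l))"
    unfolding sum.distrib[symmetric] by (rule sum.cong) (auto simp: half_weight_def)
  finally show ?thesis by (simp add: sum_distrib_left)
qed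

text \<open>
  The sign rule for \<open>s\<^sub>d\<^sub>-\<^sub>l\<close> is the one under which reflection \<open>y \<mapsto> -y\<close> maps the summand at \<open>l\<close> to the one at
  \<open>d - l\<close> up to the factor \<open>(-1)\<^sup>d\<close>. So summands at \<open>l\<close> and \<open>d - l\<close> agree in degrees of the parity of \<open>d\<close>, and
  cancel in the other degrees (the lemma after this one).
\<close>

lemma sign_poly_coeff_half_sum:
  assumes "sign_sequence d s" "2 * e \<le> d"
  shows "sign_poly_coeff d s (d - 2 * e) = 2 * (\<Sum>l\<le>d div 2. half_weight d l * (of_int (s l) / (fact l * fact (d - l)) *
     coeff ([:1, 1:] ^ l * [:1, -1:] ^ (d - l)) (d - 2 * e)))"
  unfolding sign_poly_coeff_def
proof (rule sum_half_weight[symmetric])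
  fix l assume l: "l \<le> d"
  have "s (d - l) = (-1) ^ d * s l" using assms l by (auto simp: sign_sequence_def)
  moreover have "(-1) ^ (d - 2 * e) = ((-1) ^ d :: complex)"
    using assms(2) by (simp add: minus_one_power_iff)
  ultimately show "of_int (s (d - l)) / (fact (d - l) * fact (d - (d - l))) *
         coeff ([:1, 1:] ^ (d - l) * [:1, - 1:] ^ (d - (d - l))) (d - 2 * e) =
         (of_int (s l) / (fact l * fact (d - l)) *
         coeff ([:1, 1:] ^ l * [:1, - 1:] ^ (d - l)) (d - 2 * e) :: complex)"
    using l by (simp add: coeff_reflect[of "d - l" l]) (simp add: minus_one_power_iff)
qed

lemma sign_poly_coeff_parity:
  assumes "sign_sequence d s" "odd (d - n)" "n \<le> d"
  shows "sign_poly_coeff d s n = 0"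
proof -
  have "sign_poly_coeff d s n = (\<Sum>l\<le>d. of_int (s (d - l)) / (fact (d - l) * fact (d - (d - l))) *
       coeff ([:1, 1:] ^ (d - l) * [:1, -1:] ^ (d - (d - l))) n)"
    unfolding sign_poly_coeff_def by (rule sum.reindex_bij_witness[of _ "\<lambda>l. d - l" "\<lambda>l. d - l"]) auto
  also have "\<dots> = (\<Sum>l\<le>d. - (of_int (s l) / (fact l * fact (d - l)) * coeff ([:1, 1:] ^ l * [:1, -1:] ^ (d - l)) n))"
  proof (intro sum.cong refl)
    fix l assume "l \<in> {..d}"
    then have l: "l \<le> d" by simp
    have "s (d - l) = (-1) ^ d * s l" using assms l by (auto simp: sign_sequence_def)
    moreover have "(-1) ^ n = (- ((-1) ^ d) :: complex)"
      using assms(2,3) by (auto simp: minus_one_power_iff)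
    ultimately show "of_int (s (d - l)) / (fact (d - l) * fact (d - (d - l))) *
         coeff ([:1, 1:] ^ (d - l) * [:1, - 1:] ^ (d - (d - l))) n =
         (- (of_int (s l) / (fact l * fact (d - l)) *
         coeff ([:1, 1:] ^ l * [:1, - 1:] ^ (d - l)) n) :: complex)"
      using l by (simp add: coeff_reflect[of "d - l" l]) (simp add: minus_one_power_iff)
  qed
  also have "\<dots> = - sign_poly_coeff d s n" by (simp add: sign_poly_coeff_def sum_negf)
  finally show ?thesis by simp
qed

text \<open>
  The sum over \<open>p + q = d - 2e\<close> in \<open>z\<^sub>i\<close> is a coefficient of \<open>(1 + y)\<^sup>l (1 - y)\<^sup>d\<^sup>-\<^sup>l\<close>, and the sum over \<open>l\<close> then collects these
  coefficients with the signs.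
\<close>

lemma zseq_sign_poly_coeff:
  assumes "sign_sequence d s" "2 * i \<le> d"
  shows "zseq d s i = fact d * fact (2 * d - 4 * i + 1) / (2 ^ (2 * i) * (fact (d - 2 * i))\<^sup>2) *
     (\<Sum>e\<le>i. fact (d - 2 * e) * fact (d - i - e) / (fact (2 * d - 2 * i - 2 * e + 1) * fact (i - e)) *
        sign_poly_coeff d s (d - 2 * e))"
proof -
  have p: "(2 powi (2 * int i - 1) :: complex) = 2 ^ (2 * i) / 2"
    by (simp add: power_int_diff power_int_mult power_mult)
  define g :: "nat \<Rightarrow> complex" where "g e = fact (d - 2 * e) * fact (d - i - e) / (fact (2 * d - 2 * i - 2 * e + 1) * fact (i - e))" for e
  define w where "w l = half_weight d l * (of_int (s l) / (fact l * fact (d - l)))" for l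
  define S where "S e l = {(p, q). p \<le> l \<and> q \<le> d - l \<and> p + q = d - 2 * e}" for e l
  have finS: "finite (S e l)" for e l
    by (rule finite_subset[of _ "{..l} \<times> {..d - l}"]) (auto simp: S_def)
  have set: "{(e, l, p, q). e \<le> i \<and> l \<le> d div 2 \<and> p \<le> l \<and> q \<le> d - l \<and> p + q = d - 2 * e} =
     (SIGMA e:{..i}. SIGMA l:{..d div 2}. S e l)" by (auto simp: S_def)
  have summand: "of_int (s l) * half_weight d l * (-1) ^ q *
        (fact (d - 2 * e) * fact (d - i - e) /
         (fact (2 * d - 2 * i - 2 * e + 1) * fact (i - e) * fact p * fact q *
          fact (l - p) * fact (d - l - q))) = g e * w l * ((-1) ^ q * of_nat (l choose p) * of_nat ((d - l) choose q))"
    if "p \<le> l" "q \<le> d - l" for e l p q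
    using that by (simp add: g_def w_def binomial_fact mult_ac)
  have "(\<Sum>(e, l, p, q) \<in> {(e, l, p, q). e \<le> i \<and> l \<le> d div 2 \<and> p \<le> l \<and> q \<le> d - l \<and> p + q = d - 2 * e}.
        of_int (s l) * half_weight d l * (-1) ^ q *
        (fact (d - 2 * e) * fact (d - i - e) /
         (fact (2 * d - 2 * i - 2 * e + 1) * fact (i - e) * fact p * fact q *
          fact (l - p) * fact (d - l - q)))) =
     (\<Sum>e\<le>i. \<Sum>l\<le>d div 2. \<Sum>(p,q)\<in>S e l. of_int (s l) * half_weight d l * (-1) ^ q *
        (fact (d - 2 * e) * fact (d - i - e) /
         (fact (2 * d - 2 * i - 2 * e + 1) * fact (i - e) * fact p * fact q *
          fact (l - p) * fact (d - l - q))))"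
    unfolding set by (simp add: sum.Sigma finS)
  also have "\<dots> = (\<Sum>e\<le>i. \<Sum>l\<le>d div 2. \<Sum>(p,q)\<in>S e l. g e * w l * ((-1) ^ q * of_nat (l choose p) * of_nat ((d - l) choose q)))"
    by (intro sum.cong refl) (auto simp: S_def summand[simplified])
  also have "\<dots> = (\<Sum>e\<le>i. \<Sum>l\<le>d div 2. g e * w l * coeff ([:1, 1:] ^ l * [:1, -1:] ^ (d - l)) (d - 2 * e))"
    unfolding coeff_power_mult_power S_def by (simp add: sum_distrib_left case_prod_beta)
  also have "\<dots> = (\<Sum>e\<le>i. g e * (sign_poly_coeff d s (d - 2 * e) / 2))"
  proof (intro sum.cong refl)
    fix e assume "e \<in> {..i}"
    then have "2 * e \<le> d" using assms(2) by simp
    then have "sign_poly_coeff d s (d - 2 * e) / 2 =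
      (\<Sum>l\<le>d div 2. w l * coeff ([:1, 1:] ^ l * [:1, -1:] ^ (d - l)) (d - 2 * e))"
      by (simp add: sign_poly_coeff_half_sum[OF assms(1)] w_def mult.assoc)
    then show "(\<Sum>l\<le>d div 2. g e * w l * coeff ([:1, 1:] ^ l * [:1, -1:] ^ (d - l)) (d - 2 * e)) =
      g e * (sign_poly_coeff d s (d - 2 * e) / 2)"
      by (simp only: sum_distrib_left mult.assoc)
  qed
  also have "\<dots> = (\<Sum>e\<le>i. g e * sign_poly_coeff d s (d - 2 * e)) / 2"
    by (simp add: sum_divide_distrib)
  finally show ?thesis
    unfolding zseq_def p g_def by (simp only:) (simp add: mult_ac)
qed

text \<open>
  Substituting \<open>y = x = (1 - t) / (1 + t)\<close> into the polynomial with the coefficients \<open>sign_poly_coeff d s n\<close> and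
  clearing denominators turns \<open>1 + y\<close> and \<open>1 - y\<close> into \<open>2\<close> and \<open>2t\<close>, so each sign is left alone with its own power
  of \<open>t\<close>. The coefficients of the wrong parity vanish, which leaves the exponents \<open>d - 2e\<close>.
\<close>

lemma sign_poly_coeff_inversion:
  assumes "sign_sequence d s"
  shows "(\<Sum>e\<le>d div 2. smult (sign_poly_coeff d s (d - 2 * e)) ([:1, 1:] ^ (2 * e) * [:1, -1:] ^ (d - 2 * e))) =
    (\<Sum>l\<le>d. monom (of_int (s l) * 2 ^ d / (fact l * fact (d - l))) (d - l))"
proof -
  define M :: "nat \<Rightarrow> complex poly" where "M j = [:1, -1:] ^ j * [:1, 1:] ^ (d - j)" for j
  have "(\<Sum>e\<le>d div 2. smult (sign_poly_coeff d s (d - 2 * e)) ([:1, 1:] ^ (2 * e) * [:1, -1:] ^ (d - 2 * e))) =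
    (\<Sum>j | j \<le> d \<and> even (d - j). smult (sign_poly_coeff d s j) (M j))"
    by (rule sum.reindex_bij_witness[of _ "\<lambda>j. (d - j) div 2" "\<lambda>e. d - 2 * e"]) (auto simp: M_def mult.commute)
  also have "\<dots> = (\<Sum>j\<le>d. smult (sign_poly_coeff d s j) (M j))"
    by (rule sum.mono_neutral_left) (auto simp: sign_poly_coeff_parity[OF assms])
  also have "\<dots> = (\<Sum>j\<le>d. \<Sum>l\<le>d. smult (of_int (s l) / (fact l * fact (d - l)))
      (smult (coeff ([:1, 1:] ^ l * [:1, -1:] ^ (d - l)) j) (M j)))"
    by (simp add: sign_poly_coeff_def smult_sum)
  also have "\<dots> = (\<Sum>l\<le>d. \<Sum>j\<le>d. smult (of_int (s l) / (fact l * fact (d - l)))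
      (smult (coeff ([:1, 1:] ^ l * [:1, -1:] ^ (d - l)) j) (M j)))"
    by (rule sum.swap)
  also have "\<dots> = (\<Sum>l\<le>d. smult (of_int (s l) / (fact l * fact (d - l)))
      (\<Sum>j\<le>d. smult (coeff ([:1, 1:] ^ l * [:1, -1:] ^ (d - l)) j) (M j)))"
    by (simp only: poly_eq_iff coeff_sum coeff_smult sum_distrib_left simp_thms)
  also have "\<dots> = (\<Sum>l\<le>d. monom (of_int (s l) * 2 ^ d / (fact l * fact (d - l))) (d - l))"
  proof (intro sum.cong refl)
    fix l assume "l \<in> {..d}"
    then have l: "l + (d - l) = d" by simp
    have "(\<Sum>j\<le>d. smult (coeff ([:1, 1:] ^ l * [:1, -1:] ^ (d - l)) j) (M j)) =
       ([:1, 1:] + [:1, -1:]) ^ l * ([:1, 1:] - [:1, -1:]) ^ (d - l)"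
      using homogenization_power_product[of l "d - l" "[:1, -1:]" "[:1, 1:]"] unfolding l M_def .
    also have "([:1, 1:] + [:1, -1:] :: complex poly) = monom 2 0"
      by (simp add: monom_altdef)
    also have "([:1, 1:] - [:1, -1:] :: complex poly) = monom 2 1"
      by (simp add: monom_altdef)
    also have "monom 2 0 ^ l * monom 2 1 ^ (d - l) = monom (2 ^ d :: complex) (d - l)"
      by (simp add: monom_power mult_monom power_add[symmetric] l)
    finally show "smult (of_int (s l) / (fact l * fact (d - l)))
      (\<Sum>j\<le>d. smult (coeff ([:1, 1:] ^ l * [:1, -1:] ^ (d - l)) j) (M j)) =
      monom (of_int (s l) * 2 ^ d / (fact l * fact (d - l))) (d - l)"
      by (simp add: smult_monom)
  qed
  finally show ?thesis .
qed

section \<open>The eigenvalues of \<open>\<sigma>\<close>\<close>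

lemma transvectant_bimonom_legendre:
  assumes "2 * i \<le> d" "l \<le> d"
  shows "transvectant (2 * (d - 2 * i)) d (d - 2 * i) (bimonom (d - 2 * i) (d - 2 * i)) (bimonom (d - l) l) =
    cscale ((fact (d - 2 * i))\<^sup>2 * fact l * fact (d - l) / (fact (2 * (d - 2 * i)) * fact d) *
      coeff ([:1, 1:] ^ (2 * i) * legendre (d - 2 * i)) (d - l)) (bimonom (d - l) l)"
proof -
  define r where "r = d - 2 * i"
  have r: "r \<le> d" "d - r = 2 * i" using assms by (auto simp: r_def)
  define S where "S = (\<Sum>k\<le>r. (-1) ^ k * of_nat (r choose k) * of_nat (l choose (r - k)) * of_nat ((d - l) choose k) :: complex)"
  have "fact r ^ 3 * fact (d - r) / (fact (2 * r) * fact d) * S =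
     (fact r)\<^sup>2 / (fact (2 * r) * fact d) * (fact (d - r) * fact r * S)"
    by (simp add: power2_eq_square power3_eq_cube)
  also have "fact (d - r) * fact r * S = fact l * fact (d - l) * coeff ([:1, 1:] ^ (2 * i) * legendre r) (d - l)"
    using transvectant_sum_eq_coeff[OF r(1) assms(2)] by (simp only: S_def r(2))
  finally show ?thesis
    using transvectant_bimonom[OF r(1) assms(2)] unfolding S_def r_def[symmetric] by simp
qed

text \<open>
  After the transvectant's normalization is moved into \<open>z\<^sub>i\<close>, what remains besides factors in \<open>d\<close> and \<open>l\<close> is the
  coefficient of \<open>P\<^sub>d\<^sub>-\<^sub>2\<^sub>i\<close> in the Legendre expansion of \<open>\<Sum>\<^sub>n sign_poly_coeff d s n x\<^sup>n\<close>, computed monomial by monomial.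
  The exponent \<open>d - 2e\<close> contributes only for \<open>e \<le> i\<close>, since \<open>x\<^sup>n\<close> involves no Legendre polynomial of degree above \<open>n\<close>.
\<close>

lemma zseq_legendre_coeff:
  assumes "sign_sequence d s" "2 * i \<le> d"
  shows "zseq d s i * ((fact (d - 2 * i))\<^sup>2 * fact l * fact (d - l) / (fact (2 * (d - 2 * i)) * fact d)) =
    fact l * fact (d - l) / 2 ^ d *
     (\<Sum>e\<le>i. sign_poly_coeff d s (d - 2 * e) * (of_nat (2 * (d - 2 * i) + 1) * legendre_coeff (d - 2 * e) (i - e)))"
proof -
  define r where "r = d - 2 * i"
  have r: "2 * d - 4 * i + 1 = Suc (2 * r)" "(2 ^ d :: complex) = 2 ^ (2 * i) * 2 ^ r"
    using assms(2) by (auto simp: r_def power_add[symmetric])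
  define K where "K = (\<Sum>e\<le>i. sign_poly_coeff d s (d - 2 * e) * legendre_coeff (d - 2 * e) (i - e))"
  have "(\<Sum>e\<le>i. fact (d - 2 * e) * fact (d - i - e) / (fact (2 * d - 2 * i - 2 * e + 1) * fact (i - e)) *
        sign_poly_coeff d s (d - 2 * e)) = (\<Sum>e\<le>i. sign_poly_coeff d s (d - 2 * e) * legendre_coeff (d - 2 * e) (i - e) / 2 ^ r)"
  proof (intro sum.cong refl)
    fix e assume e: "e \<in> {..i}"
    have "d - 2 * e - (i - e) = d - i - e" "d - 2 * e - 2 * (i - e) = r"
      "2 * (d - 2 * e) - 2 * (i - e) + 1 = 2 * d - 2 * i - 2 * e + 1"
      using e assms(2) by (auto simp: r_def)
    then have L: "legendre_coeff (d - 2 * e) (i - e) = fact (d - 2 * e) * fact (d - i - e) * 2 ^ r / (fact (i - e) * fact (2 * d - 2 * i - 2 * e + 1))"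
      unfolding legendre_coeff_def by (simp only:)
    show "fact (d - 2 * e) * fact (d - i - e) / (fact (2 * d - 2 * i - 2 * e + 1) * fact (i - e)) *
        sign_poly_coeff d s (d - 2 * e) = sign_poly_coeff d s (d - 2 * e) * legendre_coeff (d - 2 * e) (i - e) / 2 ^ r"
      unfolding L by (simp add: mult_ac)
  qed
  also have "\<dots> = K / 2 ^ r" by (simp add: K_def sum_divide_distrib)
  finally have z: "zseq d s i = fact d * fact (Suc (2 * r)) / (2 ^ (2 * i) * (fact r)\<^sup>2) * (K / 2 ^ r)"
    unfolding zseq_sign_poly_coeff[OF assms] r(1) r_def[symmetric] by simp
  have f: "fact (Suc (2 * r)) = of_nat (2 * r + 1) * (fact (2 * r) :: complex)" by simp
  have "(\<Sum>e\<le>i. sign_poly_coeff d s (d - 2 * e) * (of_nat (2 * r + 1) * legendre_coeff (d - 2 * e) (i - e))) = of_nat (2 * r + 1) * K"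
    by (simp only: K_def sum_distrib_left mult.left_commute)
  then show ?thesis unfolding r_def[symmetric] z f r(2)
    by (simp del: of_nat_Suc of_nat_add of_nat_mult)
qed

lemma legendre_expansion_shifted:
  assumes "2 * e \<le> d"
  shows "(\<Sum>i\<in>{e..d div 2}. smult (of_nat (2 * (d - 2 * i) + 1) * legendre_coeff (d - 2 * e) (i - e))
      ([:1, 1:] ^ (2 * i) * legendre (d - 2 * i))) = [:1, 1:] ^ (2 * e) * [:1, -1:] ^ (d - 2 * e)"
proof -
  have "[:1, 1:] ^ (2 * e) * [:1, -1:] ^ (d - 2 * e) =
    (\<Sum>j\<le>(d - 2 * e) div 2. smult (of_nat (2 * (d - 2 * e - 2 * j) + 1) * legendre_coeff (d - 2 * e) j)
      ([:1, 1:] ^ (2 * e + 2 * j) * legendre (d - 2 * e - 2 * j)))"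
    unfolding power_legendre_expansion[of "d - 2 * e"] sum_distrib_left
    by (simp only: power_add mult_smult_right mult.assoc)
  also have "\<dots> = (\<Sum>i\<in>{e..d div 2}. smult (of_nat (2 * (d - 2 * i) + 1) * legendre_coeff (d - 2 * e) (i - e))
      ([:1, 1:] ^ (2 * i) * legendre (d - 2 * i)))"
  proof (rule sum.reindex_bij_witness[of _ "\<lambda>i. i - e" "\<lambda>j. j + e"])
    fix j assume j: "j \<in> {..(d - 2 * e) div 2}"
    have "d - 2 * (j + e) = d - 2 * e - 2 * j" "2 * (j + e) = 2 * e + 2 * j" by auto
    then show "smult (of_nat (2 * (d - 2 * (j + e)) + 1) * legendre_coeff (d - 2 * e) (j + e - e))
      ([:1, 1:] ^ (2 * (j + e)) * legendre (d - 2 * (j + e))) =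
      smult (of_nat (2 * (d - 2 * e - 2 * j) + 1) * legendre_coeff (d - 2 * e) j)
      ([:1, 1:] ^ (2 * e + 2 * j) * legendre (d - 2 * e - 2 * j))"
      by (simp only: add_diff_cancel_right')
  qed (use assms in auto)
  finally show ?thesis ..
qed

text \<open>
  The Legendre expansion of the polynomial with Bernstein coefficients \<open>s\<^sub>l\<close>, compared at one Bernstein
  coefficient. Interchanging the sums over \<open>e\<close> and \<open>i\<close> lets the Legendre series of each \<open>x\<^sup>d\<^sup>-\<^sup>2\<^sup>e\<close> collapse first.
\<close>

lemma sum_zseq_transvectant_factor:
  assumes "sign_sequence d s" "l \<le> d"
  shows "(\<Sum>i\<le>d div 2. zseq d s i * ((fact (d - 2 * i))\<^sup>2 * fact l * fact (d - l) / (fact (2 * (d - 2 * i)) * fact d) *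
      coeff ([:1, 1:] ^ (2 * i) * legendre (d - 2 * i)) (d - l))) = of_int (s l)"
proof -
  define c :: complex where "c = fact l * fact (d - l) / 2 ^ d"
  define a :: "nat \<Rightarrow> nat \<Rightarrow> complex" where
    "a i e = of_nat (2 * (d - 2 * i) + 1) * legendre_coeff (d - 2 * e) (i - e)" for i e
  define B where "B i = [:1, 1:] ^ (2 * i) * legendre (d - 2 * i)" for i
  have "(\<Sum>i\<le>d div 2. zseq d s i * ((fact (d - 2 * i))\<^sup>2 * fact l * fact (d - l) / (fact (2 * (d - 2 * i)) * fact d) *
      coeff (B i) (d - l))) = (\<Sum>i\<le>d div 2. \<Sum>e\<le>i. c * (sign_poly_coeff d s (d - 2 * e) * (a i e * coeff (B i) (d - l))))"
  proof (intro sum.cong refl)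
    fix i assume "i \<in> {..d div 2}"
    then have "2 * i \<le> d" by auto
    from zseq_legendre_coeff[OF assms(1) this, of l]
    show "zseq d s i * ((fact (d - 2 * i))\<^sup>2 * fact l * fact (d - l) / (fact (2 * (d - 2 * i)) * fact d) *
      coeff (B i) (d - l)) = (\<Sum>e\<le>i. c * (sign_poly_coeff d s (d - 2 * e) * (a i e * coeff (B i) (d - l))))"
      unfolding mult.assoc[symmetric, of "zseq d s i"] c_def[symmetric] a_def[symmetric]
      by (simp only: sum_distrib_left sum_distrib_right mult.assoc)
  qed
  also have "\<dots> = (\<Sum>e\<le>d div 2. \<Sum>i\<in>{e..d div 2}. c * (sign_poly_coeff d s (d - 2 * e) * (a i e * coeff (B i) (d - l))))"
    unfolding sum.Sigma[OF finite_atMost ballI[OF finite_atMost]] sum.Sigma[OF finite_atMost ballI[OF finite_atLeastAtMost]]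
    by (rule sum.reindex_bij_witness[of _ "\<lambda>(e, i). (i, e)" "\<lambda>(i, e). (e, i)"]) auto
  also have "\<dots> = c * coeff (\<Sum>e\<le>d div 2. smult (sign_poly_coeff d s (d - 2 * e)) (\<Sum>i\<in>{e..d div 2}. smult (a i e) (B i))) (d - l)"
    by (simp add: coeff_sum sum_distrib_left)
  also have "(\<Sum>e\<le>d div 2. smult (sign_poly_coeff d s (d - 2 * e)) (\<Sum>i\<in>{e..d div 2}. smult (a i e) (B i))) =
     (\<Sum>e\<le>d div 2. smult (sign_poly_coeff d s (d - 2 * e)) ([:1, 1:] ^ (2 * e) * [:1, -1:] ^ (d - 2 * e)))"
    unfolding a_def B_def by (intro sum.cong refl arg_cong2[of _ _ _ _ smult] legendre_expansion_shifted) auto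
  also have "c * coeff \<dots> (d - l) =
      c * (\<Sum>k\<le>d. if k = l then of_int (s l) * 2 ^ d / (fact l * fact (d - l)) else 0)"
    unfolding sign_poly_coeff_inversion[OF assms(1)] coeff_sum using assms(2)
    by (intro arg_cong[of _ _ "\<lambda>x. c * x"] sum.cong) auto
  also have "\<dots> = of_int (s l)"
    using assms(2) by (simp add: c_def)
  finally show ?thesis unfolding B_def .
qed

lemma sigma_bimonom:
  assumes "sign_sequence d s" "l \<le> d"
  shows "sigma d (X1 * X2) (zseq d s) (bimonom (d - l) l) = cscale (of_int (s l)) (bimonom (d - l) l)"
proof -
  have "(X1 * X2) ^ n = bimonom n n" for n
    by (simp add: X1_X2_power power_mult_distrib)
  then have "sigma d (X1 * X2) (zseq d s) (bimonom (d - l) l) =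
     (\<Sum>i\<le>d div 2. cscale (zseq d s i * ((fact (d - 2 * i))\<^sup>2 * fact l * fact (d - l) / (fact (2 * (d - 2 * i)) * fact d) *
      coeff ([:1, 1:] ^ (2 * i) * legendre (d - 2 * i)) (d - l))) (bimonom (d - l) l))"
    unfolding sigma_def discr_X1_X2 using assms(2)
    by (intro sum.cong refl) (simp add: transvectant_bimonom_legendre)
  then show ?thesis
    by (simp only: bipoly.scale_sum_left[symmetric] sum_zseq_transvectant_factor[OF assms])
qed

lemma sigma_form:
  assumes "sign_sequence d s" "F \<in> forms d"
  shows "sigma d (X1 * X2) (zseq d s) F =
    (\<Sum>l\<le>d. cscale (of_int (s l) * coeff (coeff F (d - l)) l) (bimonom (d - l) l))"
proof -
  interpret sig: Vector_Spaces.linear cscale cscale "sigma d (X1 * X2) (zseq d s)"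
    by (rule sigma_linear)
  show ?thesis
    by (subst form_expansion[OF assms(2)])
      (simp add: sig.sum sig.scale sigma_bimonom[OF assms(1)] mult.commute)
qed

lemma coeff_sigma:
  assumes "sign_sequence d s" "F \<in> forms d" "l \<le> d"
  shows "coeff (coeff (sigma d (X1 * X2) (zseq d s) F) (d - l)) l =
    of_int (s l) * coeff (coeff F (d - l)) l"
proof -
  have "coeff (coeff (sigma d (X1 * X2) (zseq d s) F) (d - l)) l =
     (\<Sum>k\<le>d. of_int (s k) * coeff (coeff F (d - k)) k * (if d - l = d - k \<and> l = k then 1 else 0))"
    by (simp only: sigma_form[OF assms(1,2)] coeff_sum coeff_cscale coeff_bimonom)
  also have "\<dots> = (\<Sum>k\<le>d. if k = l then of_int (s l) * coeff (coeff F (d - l)) l else 0)"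
    by (rule sum.cong) auto
  finally show ?thesis using assms(3) by simp
qed

lemma sigma_in_forms:
  assumes "sign_sequence d s" "F \<in> forms d"
  shows "sigma d (X1 * X2) (zseq d s) F \<in> forms d"
  unfolding sigma_form[OF assms]
  by (auto simp: forms_def coeff_sum coeff_cscale coeff_bimonom
      elim!: sum.not_neutral_contains_not_neutral split: if_splits)

section \<open>The locus above \<open>x\<^sub>1 x\<^sub>2\<close>\<close>

lemma form_eqI:
  assumes "F \<in> forms d" "G \<in> forms d" "\<And>l. l \<le> d \<Longrightarrow> coeff (coeff F (d - l)) l = coeff (coeff G (d - l)) l"
  shows "F = G"
  by (subst form_expansion[OF assms(1)], subst form_expansion[OF assms(2)]) (simp add: assms(3))

lemma cscale_in_forms: "F \<in> forms d \<Longrightarrow> cscale c F \<in> forms d"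
  by (auto simp: forms_def coeff_cscale)

lemma span_monomials_iff:
  assumes "F \<in> forms d"
  shows "F \<in> bipoly.span {X1 ^ (d - i) * X2 ^ i | i. i \<le> d \<and> P i} \<longleftrightarrow>
    (\<forall>l\<le>d. \<not> P l \<longrightarrow> coeff (coeff F (d - l)) l = 0)"
proof
  assume "F \<in> bipoly.span {X1 ^ (d - i) * X2 ^ i | i. i \<le> d \<and> P i}"
  then show "\<forall>l\<le>d. \<not> P l \<longrightarrow> coeff (coeff F (d - l)) l = 0"
  proof (induction rule: bipoly.span_induct_alt)
    case (step c x y)
    then show ?case by (auto simp: X1_X2_power coeff_cscale coeff_bimonom split: if_splits)
  qed simp
next
  assume *: "\<forall>l\<le>d. \<not> P l \<longrightarrow> coeff (coeff F (d - l)) l = 0"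
  have "cscale (coeff (coeff F (d - l)) l) (bimonom (d - l) l) \<in> bipoly.span {X1 ^ (d - i) * X2 ^ i | i. i \<le> d \<and> P i}"
    if "l \<le> d" for l
  proof (cases "P l")
    case True
    then show ?thesis using that by (intro bipoly.span_scale bipoly.span_base) (auto simp: X1_X2_power)
  next
    case False
    then show ?thesis using that * by (simp add: bipoly.span_zero)
  qed
  then have "(\<Sum>l\<le>d. cscale (coeff (coeff F (d - l)) l) (bimonom (d - l) l)) \<in> bipoly.span {X1 ^ (d - i) * X2 ^ i | i. i \<le> d \<and> P i}"
    by (intro bipoly.span_sum) auto
  then show "F \<in> bipoly.span {X1 ^ (d - i) * X2 ^ i | i. i \<le> d \<and> P i}"
    by (subst form_expansion[OF assms])
qed

lemma sigma_eq_cscale_iff: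
  assumes "sign_sequence d s" "F \<in> forms d"
  shows "sigma d (X1 * X2) (zseq d s) F = cscale (of_int c) F \<longleftrightarrow>
    F \<in> bipoly.span {X1 ^ (d - i) * X2 ^ i | i. i \<le> d \<and> s i = c}"
proof -
  have "sigma d (X1 * X2) (zseq d s) F = cscale (of_int c) F \<longleftrightarrow>
    (\<forall>l\<le>d. of_int (s l) * coeff (coeff F (d - l)) l = of_int c * coeff (coeff F (d - l)) l)"
    (is "?S = ?G \<longleftrightarrow> _")
  proof -
    have "?S = ?G \<longleftrightarrow> (\<forall>l\<le>d. coeff (coeff ?S (d - l)) l = coeff (coeff ?G (d - l)) l)"
      by (auto intro: form_eqI[OF sigma_in_forms[OF assms(1,2)] cscale_in_forms[OF assms(2)]])
    then show ?thesis by (simp add: coeff_sigma[OF assms(1,2)] coeff_cscale)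
  qed
  also have "\<dots> \<longleftrightarrow> (\<forall>l\<le>d. s l \<noteq> c \<longrightarrow> coeff (coeff F (d - l)) l = 0)"
    by auto
  finally show ?thesis by (simp add: span_monomials_iff[OF assms(2)])
qed

lemma proj_pt_eq_iff: "proj_pt A = proj_pt B \<longleftrightarrow> (\<exists>c. c \<noteq> 0 \<and> A = cscale c B)"
proof
  have "A = cscale 1 A" by simp
  then have "A \<in> proj_pt A" unfolding proj_pt_def by (metis (mono_tags, lifting) CollectI one_neq_zero)
  moreover assume "proj_pt A = proj_pt B"
  ultimately show "\<exists>c. c \<noteq> 0 \<and> A = cscale c B" by (auto simp: proj_pt_def)
next
  assume "\<exists>c. c \<noteq> 0 \<and> A = cscale c B"
  then obtain c where c: "c \<noteq> 0" "A = cscale c B" by blast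
  have "cscale k B \<in> proj_pt A" if "k \<noteq> 0" for k
    using c that by (auto simp: proj_pt_def intro!: exI[of _ "k / c"])
  then show "proj_pt A = proj_pt B"
    using c by (auto simp: proj_pt_def)
qed

lemma cscale_eq_iff: "cscale c A = cscale c B \<longleftrightarrow> c = 0 \<or> A = B"
  by (auto simp: bipoly.scale_cancel_left)

text \<open>
  Membership in the locus only asserts the equation for some pair of representatives. Rescaling \<open>Q\<close> by \<open>a\<close> and
  \<open>F\<close> by \<open>b\<close> multiplies both sides by \<open>a\<^sup>d b\<close>, or by its square when \<open>d\<close> is odd, so the equation may be read at
  \<open>Q = x\<^sub>1 x\<^sub>2\<close>, where \<open>\<Delta> = 1\<close>.
\<close>

lemma locus_X1_X2_iff:
  assumes "F \<in> forms d" "F \<noteq> 0"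
  shows "(proj_pt (X1 * X2), proj_pt F) \<in> locus d z \<longleftrightarrow>
    (if even d then sigma d (X1 * X2) z F = F else (sigma d (X1 * X2) z F)\<^sup>2 = F\<^sup>2)"
proof
  assume "(proj_pt (X1 * X2), proj_pt F) \<in> locus d z"
  then obtain Q' F' where eq: "proj_pt Q' = proj_pt (X1 * X2)" "proj_pt F' = proj_pt F"
    and L: "if even d then sigma d Q' z F' = discr Q' ^ (d div 2) * F'
         else (sigma d Q' z F')\<^sup>2 = discr Q' ^ d * F'\<^sup>2"
    unfolding locus_def by auto
  obtain a b where a: "a \<noteq> 0" "Q' = cscale a (X1 * X2)" and b: "b \<noteq> 0" "F' = cscale b F"
    using eq by (auto simp: proj_pt_eq_iff)
  interpret sig: Vector_Spaces.linear cscale cscale "sigma d (X1 * X2) z"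
    by (rule sigma_linear)
  have sig: "sigma d Q' z F' = cscale (a ^ d * b) (sigma d (X1 * X2) z F)"
    unfolding a b sigma_cscale_left sig.scale by simp
  have dis: "discr Q' ^ n = cscale (a ^ (2 * n)) 1" for n
    unfolding a discr_cscale discr_X1_X2 cscale_power by (simp add: power_mult)
  show "if even d then sigma d (X1 * X2) z F = F else (sigma d (X1 * X2) z F)\<^sup>2 = F\<^sup>2"
  proof (cases "even d")
    case True
    then have "cscale (a ^ d * b) (sigma d (X1 * X2) z F) = cscale (a ^ d * b) F"
      using L unfolding sig dis unfolding b(2) by (simp add: cscale_mult_left)
    then show ?thesis using True a b by (simp add: cscale_eq_iff)
  next
    case False
    then have "cscale ((a ^ d * b)\<^sup>2) ((sigma d (X1 * X2) z F)\<^sup>2) = cscale ((a ^ d * b)\<^sup>2) (F\<^sup>2)"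
      using L unfolding sig dis unfolding b(2) cscale_power
      by (simp add: cscale_mult_left power_mult_distrib power_mult[symmetric] mult.commute)
    then show ?thesis using False a b by (simp add: cscale_eq_iff)
  qed
next
  assume *: "if even d then sigma d (X1 * X2) z F = F else (sigma d (X1 * X2) z F)\<^sup>2 = F\<^sup>2"
  have X: "X1 * X2 = bimonom 1 1" using X1_X2_power[of 1 1] by simp
  have "X1 * X2 \<in> forms 2" "X1 * X2 \<noteq> 0"
    by (auto simp: X forms_def coeff_bimonom poly_eq_iff split: if_splits)
  then show "(proj_pt (X1 * X2), proj_pt F) \<in> locus d z"
    unfolding locus_def using assms * by (intro CollectI exI[of _ "X1 * X2"] exI[of _ F]) (simp add: discr_X1_X2)
qed

theorem theorem4p1:
  fixes d :: nat and s :: "nat \<Rightarrow> int" and F :: bipoly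
  assumes "d \<ge> 1"
    and "sign_sequence d s"
    and "F \<in> forms d"
    and "F \<noteq> 0"
  shows "(even d \<longrightarrow>
           ((proj_pt (X1 * X2), proj_pt F) \<in> locus d (zseq d s) \<longleftrightarrow>
           F \<in> bipoly.span {X1 ^ (d - i) * X2 ^ i | i. i \<le> d \<and> s i = 1})) \<and>
         (odd d \<longrightarrow>
           ((proj_pt (X1 * X2), proj_pt F) \<in> locus d (zseq d s) \<longleftrightarrow>
           F \<in> bipoly.span {X1 ^ (d - i) * X2 ^ i | i. i \<le> d \<and> s i = 1} \<or>
           F \<in> bipoly.span {X1 ^ (d - i) * X2 ^ i | i. i \<le> d \<and> s i = -1}))"
proof -
  have "sigma d (X1 * X2) (zseq d s) F = F \<longleftrightarrow>
      F \<in> bipoly.span {X1 ^ (d - i) * X2 ^ i | i. i \<le> d \<and> s i = 1}"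
    using sigma_eq_cscale_iff[OF assms(2,3), of 1] by simp
  moreover have "sigma d (X1 * X2) (zseq d s) F = - F \<longleftrightarrow>
      F \<in> bipoly.span {X1 ^ (d - i) * X2 ^ i | i. i \<le> d \<and> s i = -1}"
    using sigma_eq_cscale_iff[OF assms(2,3), of "-1"] by simp
  ultimately show ?thesis
    by (simp add: locus_X1_X2_iff[OF assms(3,4)] power2_eq_iff)
qed

end
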